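(* Let $\lVert\cdot\rVert_A$ and $\lVert\cdot\rVert_B$ be rearrangement-invariant Banach function norms over $([0,\infty),\lambda)$ and let $A$ and $B$ be the corresponding rearrangement-invariant Banach function spaces. Then (1) $WL(L^\infty,B)\hookrightarrow WL(A,B)$, (2) $WL(A,L^1)\hookrightarrow WL(A,B)$, (3) $WL(A,B)\hookrightarrow WL(L^1,B)$, (4) $WL(A,B)\hookrightarrow WL(A,L^\infty)$.
   Context: $\lambda$ is Lebesgue measure on $[0,\infty)$; $M$ is the set of extended complex-valued $\lambda$-measurable functions on $[0,\infty)$ (identified when equal a.e.), $M_+$ the non-negative ones. The non-increasing rearrangement of $f\in M$ is $f^*(t)=\inf\{s\ge 0:\lambda(\{|f|>s\})\le t\}$. $L^1,L^\infty$ are the Lebesgue spaces over $([0,\infty),\lambda)$. A Banach function norm is a map $\lVert\cdot\rVert:M\to[0,\infty]$ with $\lVert\,|f|\,\rVert=\lVert f\rVert$ whose restriction to $M_+$ satisfies: (P1) it is positively homogeneous, $\lVert f\rVert=0\Leftrightarrow f=0$ a.e., and $\lVert f+g\rVert\le\lVert f\rVert+\lVert g\rVert$; (P2) $f\le g$ a.e. implies $\lVert f\rVert\le\lVert g\rVert$; (P3) $f_n\uparrow f$ a.e. implies $\lVert f_n\rVert\uparrow\lVert f\rVert$; (P4) $\lVert\chi_E\rVert<\infty$ whenever $\lambda(E)<\infty$; (P5) for every $E$ with $\lambda(E)<\infty$ there is a finite $C_E$ with $\int_E f\,d\lambda\le C_E\lVert f\rVert$ for all $f\in M_+$. It is rearrangement-invariant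 (r.i.) if $f^*=g^*$ implies $\lVert f\rVert=\lVert g\rVert$. The corresponding Banach function space is $X=\{f\in M:\lVert f\rVert_X<\infty\}$. For r.i. Banach function norms: $\lVert f\rVert_{WL(A,B)}=\lVert f^*\chi_{[0,1]}\rVert_A+\lVert f^*\chi_{(1,\infty)}\rVert_B$ for $f\in M$, and $WL(A,B)=\{f\in M:\lVert f\rVert_{WL(A,B)}<\infty\}$. $Y\hookrightarrow X$ means $Y\subseteq X$ and the identity $Y\to X$ is continuous, i.e. $\lVert f\rVert_X\le K\lVert f\rVert_Y$ for all $f\in Y$ with some finite constant $K$. *)

theory Defs
  imports "HOL-Probability.Essential_Supremum"
begin

abbreviation halfline :: "real measure"  (\<open>\<lambda>\<^sub>+\<close>)
  where "\<lambda>\<^sub>+ \<equiv> lebesgue_on {0..}"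

section \<open>Extended complex-valued measurable functions\<close>

text \<open>The values are \<open>\<complex> \<union> {\<infinity>}\<close>.\<close>

datatype ecomplex = Fin complex | CInf

primrec emod :: "ecomplex \<Rightarrow> ennreal" where
  "emod (Fin z) = ennreal (cmod z)"
| "emod CInf = \<infinity>"

definition ecomplex_of_ennreal :: "ennreal \<Rightarrow> ecomplex" where
  "ecomplex_of_ennreal x = (if x = \<infinity> then CInf else Fin (complex_of_real (enn2real x)))"

text \<open>The Borel \<open>\<sigma>\<close>-algebra of the one-point compactification of the plane: the remaining open sets,
  i.e. the neighbourhoods of \<open>\<infinity>\<close>, are complements of sets \<open>Fin ` K\<close> with \<open>K\<close> compact, so they
  need not be listed as generators.\<close>

definition ecomplex_borel :: "ecomplex measure" where
  "ecomplex_borel = sigma UNIV {Fin ` U | U. open U}"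

text \<open>Elements of \<open>Mfun\<close> (usually called \<open>M\<close>) are represented by functions on \<open>real\<close>, of which only
  the values on \<open>[0,\<infinity>)\<close> matter. No quotient by a.e. equality is taken: every functional used below
  assigns the same value to functions in \<open>Mfun\<close> that agree a.e. on \<open>[0,\<infinity>)\<close>; for Banach function
  norms this is a consequence of the axioms \<open>norm_mod\<close> and \<open>P2\<close>.\<close>

definition Mfun :: "(real \<Rightarrow> ecomplex) set" where
  "Mfun = measurable \<lambda>\<^sub>+ ecomplex_borel"

text \<open>Non-negative functions are written with values in \<^typ>\<open>ennreal\<close>, and enter \<open>Mfun\<close> via \<open>emb\<close>.\<close>

definition Mfun_plus :: "(real \<Rightarrow> ennreal) set" where
  "Mfun_plus = borel_measurable \<lambda>\<^sub>+"

definition emb :: "(real \<Rightarrow> ennreal) \<Rightarrow> real \<Rightarrow> ecomplex" where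
  "emb f = (\<lambda>x. ecomplex_of_ennreal (f x))"

section \<open>Rearrangements and Banach function norms\<close>

text \<open>The infimum of the empty set is \<open>\<infinity>\<close> in \<^typ>\<open>ennreal\<close>.\<close>

definition rearr :: "(real \<Rightarrow> ecomplex) \<Rightarrow> real \<Rightarrow> ennreal" where
  "rearr f t = Inf {ennreal s | s. 0 \<le> s \<and>
     emeasure \<lambda>\<^sub>+ {x \<in> space \<lambda>\<^sub>+. emod (f x) > ennreal s} \<le> ennreal t}"

type_synonym fnorm = "(real \<Rightarrow> ecomplex) \<Rightarrow> ennreal"

locale banach_function_norm =
  fixes N :: fnorm
  assumes norm_mod: "\<And>f. f \<in> Mfun \<Longrightarrow> N (emb (\<lambda>x. emod (f x))) = N f"
    and P1_homogeneous: "\<And>f a. f \<in> Mfun_plus \<Longrightarrow> 0 \<le> a \<Longrightarrow>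
          N (emb (\<lambda>x. ennreal a * f x)) = ennreal a * N (emb f)"
    and P1_zero: "\<And>f. f \<in> Mfun_plus \<Longrightarrow> N (emb f) = 0 \<longleftrightarrow> (AE x in \<lambda>\<^sub>+. f x = 0)"
    and P1_triangle: "\<And>f g. f \<in> Mfun_plus \<Longrightarrow> g \<in> Mfun_plus \<Longrightarrow>
          N (emb (\<lambda>x. f x + g x)) \<le> N (emb f) + N (emb g)"
    and P2: "\<And>f g. f \<in> Mfun_plus \<Longrightarrow> g \<in> Mfun_plus \<Longrightarrow> AE x in \<lambda>\<^sub>+. f x \<le> g x \<Longrightarrow> N (emb f) \<le> N (emb g)"
    and P3: "\<And>F f. (\<And>n. F n \<in> Mfun_plus) \<Longrightarrow> f \<in> Mfun_plus \<Longrightarrow>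
          AE x in \<lambda>\<^sub>+. incseq (\<lambda>n. F n x) \<and> (\<lambda>n. F n x) \<longlonglongrightarrow> f x \<Longrightarrow>
          incseq (\<lambda>n. N (emb (F n))) \<and> (\<lambda>n. N (emb (F n))) \<longlonglongrightarrow> N (emb f)"
    and P4: "\<And>E. E \<in> sets \<lambda>\<^sub>+ \<Longrightarrow> emeasure \<lambda>\<^sub>+ E < \<infinity> \<Longrightarrow> N (emb (indicator E)) < \<infinity>"
    and P5: "\<And>E. E \<in> sets \<lambda>\<^sub>+ \<Longrightarrow> emeasure \<lambda>\<^sub>+ E < \<infinity> \<Longrightarrow>
          \<exists>C<\<infinity>. \<forall>f\<in>Mfun_plus. (\<integral>\<^sup>+x\<in>E. f x \<partial>\<lambda>\<^sub>+) \<le> C * N (emb f)"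

locale ri_banach_function_norm = banach_function_norm +
  assumes rearrangement_invariant:
    "\<And>f g. f \<in> Mfun \<Longrightarrow> g \<in> Mfun \<Longrightarrow> (\<And>t. 0 \<le> t \<Longrightarrow> rearr f t = rearr g t) \<Longrightarrow> N f = N g"

definition L1_norm :: fnorm where
  "L1_norm f = (\<integral>\<^sup>+x. emod (f x) \<partial>\<lambda>\<^sub>+)"

definition Linf_norm :: fnorm where
  "Linf_norm f = esssup \<lambda>\<^sub>+ (\<lambda>x. emod (f x))"

section \<open>Wiener--Luxemburg amalgams and embeddings\<close>

definition WL :: "fnorm \<Rightarrow> fnorm \<Rightarrow> fnorm" where
  "WL N_A N_B f = N_A (emb (\<lambda>t. rearr f t * indicator {0..1} t))
                + N_B (emb (\<lambda>t. rearr f t * indicator {1<..} t))"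

definition space_of :: "fnorm \<Rightarrow> (real \<Rightarrow> ecomplex) set" where
  "space_of N = {f \<in> Mfun. N f < \<infinity>}"

text \<open>The embedding of \<open>space_of N_Y\<close> into \<open>space_of N_X\<close>; a space is given by its norm.\<close>

definition embedded :: "fnorm \<Rightarrow> fnorm \<Rightarrow> bool"  (infix \<open>\<hookrightarrow>\<close> 50) where
  "N_Y \<hookrightarrow> N_X \<longleftrightarrow> space_of N_Y \<subseteq> space_of N_X \<and>
     (\<exists>K<\<infinity>. \<forall>f\<in>space_of N_Y. N_X f \<le> K * N_Y f)"

end

(*
  Since f* is non-increasing, the number f*(1) separates the two halves of an amalgam norm: it
  bounds f* on (1,\<infinity>) and is bounded by the integral of f* over [0,1], hence, by (P5), by a multiple
  of the local norm.  This gives (3) and (4), while (1) is boundedness of f* on [0,1] and (P4).  For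
  (2), f* on (n,n+1] is at most f*(n), which is bounded by the integral of f* over (n-1,n].
  By rearrangement invariance all characteristic functions of the intervals (n,n+1] have the same
  norm, so summing these estimates bounds the global norm by the integral of f* over (1,\<infinity>) plus f*(1).
*)
theory Submission imports Defs begin

section \<open>Measurability, and unit intervals under non-increasing functions\<close>

lemma emod_ecomplex_of_ennreal [simp]: "emod (ecomplex_of_ennreal x) = x"
  by (cases x) (auto simp: ecomplex_of_ennreal_def)

text \<open>Every generator of \<open>ecomplex_borel\<close> omits \<open>CInf\<close>, so its
  preimage is cut out by two measurable conditions: \<open>f\<close> is finite, and its value lies
  in the given open set.\<close>

lemma emb_in_Mfun:
  assumes "f \<in> Mfun_plus"
  shows "emb f \<in> Mfun"
  unfolding Mfun_def ecomplex_borel_def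
proof (rule measurable_measure_of)
  have [measurable]: "f \<in> borel_measurable \<lambda>\<^sub>+"
    using assms by (simp add: Mfun_plus_def)
  fix V assume "V \<in> {Fin ` U | U. open U}"
  then obtain U where U: "V = Fin ` U" "open U" by auto
  then have [measurable]: "U \<in> sets borel" by simp
  have "emb f -` V \<inter> space \<lambda>\<^sub>+
      = {x \<in> space \<lambda>\<^sub>+. f x \<noteq> \<infinity> \<and> complex_of_real (enn2real (f x)) \<in> U}"
    by (auto simp: emb_def U ecomplex_of_ennreal_def split: if_splits)
  also have "\<dots> \<in> sets \<lambda>\<^sub>+" by measurable
  finally show "emb f -` V \<inter> space \<lambda>\<^sub>+ \<in> sets \<lambda>\<^sub>+" .
qed auto

lemma antimono_rearr: "antimono (rearr f)"
  unfolding rearr_def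
  by (intro monotoneI Inf_superset_mono Collect_mono ex_mono impI) (meson order_trans ennreal_leI)

text \<open>The superlevel sets of a non-increasing function are intervals, hence Borel.\<close>

lemma borel_measurable_antimono_ennreal:
  fixes r :: "real \<Rightarrow> ennreal"
  assumes "antimono r"
  shows "r \<in> borel_measurable borel"
proof (rule borel_measurableI_greater)
  fix y
  have "is_interval {x. y < r x}"
    unfolding is_interval_1 using antimonoD[OF assms] by (auto intro: less_le_trans)
  then show "{x \<in> space borel. y < r x} \<in> sets borel"
    using real_interval_borel_measurable by simp
qed

lemma borel_in_sets_halfline:
  assumes "S \<in> sets borel" and "S \<subseteq> {0..}"
  shows "S \<in> sets \<lambda>\<^sub>+"
  using assms by (auto simp: sets_restrict_space_iff)

lemma borel_measurable_halfline:
  "f \<in> borel_measurable borel \<Longrightarrow> f \<in> borel_measurable \<lambda>\<^sub>+"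
  by (intro measurable_restrict_space1 measurable_completion) simp

lemma cut_in_Mfun_plus:
  assumes "antimono r" and [measurable]: "S \<in> sets borel"
  shows "(\<lambda>t. r t * indicator S t) \<in> Mfun_plus"
proof -
  have [measurable]: "r \<in> borel_measurable borel"
    using assms by (rule_tac borel_measurable_antimono_ennreal)
  show ?thesis
    unfolding Mfun_plus_def by (rule borel_measurable_halfline) measurable
qed

lemma emeasure_halfline_Ioc:
  "0 \<le> a \<Longrightarrow> a \<le> b \<Longrightarrow> emeasure \<lambda>\<^sub>+ {a<..b} = ennreal (b - a)"
  by (subst emeasure_restrict_space) auto

lemma indicator_in_Mfun_plus:
  assumes [measurable]: "S \<in> sets borel"
  shows "indicator S \<in> Mfun_plus"
  unfolding Mfun_plus_def by (rule borel_measurable_halfline) measurable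

text \<open>The interval has measure one and \<open>r (a + 1)\<close> is a lower bound of
  \<open>r\<close> on it.\<close>

lemma antimono_le_nn_integral_Ioc:
  assumes r: "antimono r" and a: "0 \<le> a"
  shows "r (a + 1) \<le> (\<integral>\<^sup>+t. r t * indicator {a<..a+1} t \<partial>\<lambda>\<^sub>+)"
proof -
  have "r (a + 1) = (\<integral>\<^sup>+t. r (a + 1) * indicator {a<..a+1} t \<partial>\<lambda>\<^sub>+)"
    using a by (subst nn_integral_cmult_indicator)
      (auto intro!: borel_in_sets_halfline simp: emeasure_halfline_Ioc)
  also have "\<dots> \<le> (\<integral>\<^sup>+t. r t * indicator {a<..a+1} t \<partial>\<lambda>\<^sub>+)"
    by (intro nn_integral_mono) (auto simp: indicator_def intro: antimonoD[OF r])
  finally show ?thesis .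
qed

lemma L1_norm_emb: "L1_norm (emb f) = (\<integral>\<^sup>+x. f x \<partial>\<lambda>\<^sub>+)"
  by (simp add: L1_norm_def emb_def)

lemma Linf_norm_emb: "Linf_norm (emb f) = esssup \<lambda>\<^sub>+ f"
  by (simp add: Linf_norm_def emb_def)

text \<open>The distribution function does not see the position of the interval: above level
  \<open>s\<close> lies the whole interval, of measure one, if \<open>s < 1\<close>, and nothing
  otherwise.\<close>

lemma rearr_indicator_Ioc:
  assumes "0 \<le> a"
  shows "rearr (emb (indicator {a<..a+1})) = rearr (emb (indicator {0<..1}))"
proof -
  have "emeasure \<lambda>\<^sub>+ {x \<in> space \<lambda>\<^sub>+. ennreal s < indicator {b<..b+1} x} = (if s < 1 then 1 else 0)"
    if "0 \<le> b" "0 \<le> s" for b s :: real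
  proof -
    have "{x \<in> space \<lambda>\<^sub>+. ennreal s < indicator {b<..b+1} x} = (if s < 1 then {b<..b+1} else {})"
      using that by (auto simp: indicator_def ennreal_less_one_iff split: if_splits)
    then show ?thesis
      using that by (simp add: emeasure_halfline_Ioc)
  qed
  from this[OF assms] this[of 0, simplified] show ?thesis
    unfolding rearr_def emb_def emod_ecomplex_of_ennreal
    by (intro ext arg_cong[where f = Inf] Collect_cong ex_cong1 conj_cong refl) simp
qed

section \<open>Comparison with the essential supremum and the integral on [0,1]\<close>

context banach_function_norm
begin

text \<open>Homogeneity is assumed for real factors only. The factors below are essential suprema
  and values of \<open>r\<close> in \<open>ennreal\<close>, which become real once they are
  finite.\<close>

lemma norm_cmult:
  assumes "f \<in> Mfun_plus" and "c < \<infinity>"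
  shows "N (emb (\<lambda>x. c * f x)) = c * N (emb f)"
  using assms P1_homogeneous[OF assms(1), of "enn2real c"] by simp

text \<open>The essential supremum dominates the cut function a.e. on [0,1], and \<open>P2\<close>
  carries this over to the norm; being finite, the supremum can be pulled out as a scalar.\<close>

lemma norm_cut_le_esssup:
  assumes r: "antimono r" and fin: "Linf_norm (emb (\<lambda>t. r t * indicator {0..1} t)) < \<infinity>"
  shows "N (emb (\<lambda>t. r t * indicator {0..1} t))
    \<le> N (emb (indicator {0..1})) * Linf_norm (emb (\<lambda>t. r t * indicator {0..1} t))"
    (is "_ \<le> _ * ?S")
proof -
  have "AE t in \<lambda>\<^sub>+. r t * indicator {0..1} t \<le> ?S * indicator {0..1} t"
    using esssup_AE[of "\<lambda>t. r t * indicator {0..1} t" "\<lambda>\<^sub>+"] unfolding Linf_norm_emb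
    by eventually_elim (auto simp: indicator_def)
  then have "N (emb (\<lambda>t. r t * indicator {0..1} t)) \<le> N (emb (\<lambda>t. ?S * indicator {0..1} t))"
    by (intro P2 cut_in_Mfun_plus r) (auto intro: monotoneI)
  then show ?thesis
    by (simp add: norm_cmult[OF indicator_in_Mfun_plus fin] mult.commute[of _ ?S])
qed

text \<open>This is \<open>P5\<close> for [0,1]. The constant is chosen before \<open>r\<close>, so
  that one bound serves all rearrangements.\<close>

lemma L1_cut_le_norm:
  "\<exists>C<\<infinity>. \<forall>r. antimono r \<longrightarrow> L1_norm (emb (\<lambda>t. r t * indicator {0..1} t))
    \<le> C * N (emb (\<lambda>t. r t * indicator {0..1} t))"
proof -
  have "{0..1::real} \<in> sets \<lambda>\<^sub>+" "emeasure \<lambda>\<^sub>+ {0..1::real} < \<infinity>"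
    by (auto intro!: borel_in_sets_halfline simp: emeasure_restrict_space)
  from P5[OF this] obtain C where C: "C < \<infinity>"
    "\<And>f. f \<in> Mfun_plus \<Longrightarrow> (\<integral>\<^sup>+x\<in>{0..1}. f x \<partial>\<lambda>\<^sub>+) \<le> C * N (emb f)"
    by auto
  have "L1_norm (emb (\<lambda>t. r t * indicator {0..1} t)) \<le> C * N (emb (\<lambda>t. r t * indicator {0..1} t))"
    if "antimono r" for r
    \<comment> \<open>\<open>P5\<close> integrates over [0,1] a function that already carries the
      indicator of [0,1]; the product of the two indicators collapses to one.\<close>
    using C(2)[OF cut_in_Mfun_plus[OF that, of "{0..1}"]]
    by (simp add: L1_norm_emb mult.assoc flip: indicator_inter_arith)
  with C(1) show ?thesis by auto
qed

end

lemma antimono_one_le_L1_cut: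
  assumes r: "antimono r"
  shows "r 1 \<le> L1_norm (emb (\<lambda>t. r t * indicator {0..1} t))"
proof -
  have "r 1 \<le> (\<integral>\<^sup>+t. r t * indicator {0<..1} t \<partial>\<lambda>\<^sub>+)"
    using antimono_le_nn_integral_Ioc[OF r, of 0] by simp
  also have "\<dots> \<le> (\<integral>\<^sup>+t. r t * indicator {0..1} t \<partial>\<lambda>\<^sub>+)"
    by (intro nn_integral_mono) (auto simp: indicator_def)
  finally show ?thesis by (simp add: L1_norm_emb)
qed

lemma Linf_cut_le:
  assumes r: "antimono r"
  shows "Linf_norm (emb (\<lambda>t. r t * indicator {1<..} t)) \<le> r 1"
  unfolding Linf_norm_emb
  using cut_in_Mfun_plus[OF r, of "{1<..}"]
  by (intro esssup_I AE_I2) (auto simp: Mfun_plus_def indicator_def intro: antimonoD[OF r])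

section \<open>The global norm bounded by an integral over the tail\<close>

context ri_banach_function_norm
begin

lemma norm_indicator_Ioc:
  "0 \<le> a \<Longrightarrow> N (emb (indicator {a<..a+1})) = N (emb (indicator {0<..1}))"
  by (intro rearrangement_invariant emb_in_Mfun indicator_in_Mfun_plus)
    (simp_all add: rearr_indicator_Ioc)

text \<open>The norm reaches one unit further than the integral, since each unit interval is paid
  for by its predecessor. The first one, (1,2], has no predecessor beyond 1 and costs
  \<open>r 1\<close>.\<close>

lemma norm_cut_Ioc_le:
  assumes r: "antimono r" and fin: "r 1 < \<infinity>"
  shows "N (emb (\<lambda>t. r t * indicator {1<..real n + 2} t))
    \<le> N (emb (indicator {0<..1})) * (r 1 + (\<integral>\<^sup>+t. r t * indicator {1<..real n + 1} t \<partial>\<lambda>\<^sub>+))"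
proof (induction n)
  have step: "N (emb (\<lambda>t. r t * indicator {a<..a+1} t)) \<le> N (emb (indicator {0<..1})) * r a"
    if a: "1 \<le> a" for a
  proof -
    have "r a < \<infinity>"
      using antimonoD[OF r a] fin by (rule le_less_trans)
    have "N (emb (\<lambda>t. r t * indicator {a<..a+1} t)) \<le> N (emb (\<lambda>t. r a * indicator {a<..a+1} t))"
      by (intro P2 cut_in_Mfun_plus r AE_I2)
        (auto simp: indicator_def intro: antimonoD[OF r] monotoneI)
    also have "\<dots> = N (emb (indicator {0<..1})) * r a"
      using a by (simp add: norm_cmult[OF indicator_in_Mfun_plus \<open>r a < \<infinity>\<close>]
          norm_indicator_Ioc mult.commute)
    finally show ?thesis .
  qed
  have split: "(\<lambda>t. r t * indicator {1<..b+1} t)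
      = (\<lambda>t. r t * indicator {1<..b} t + r t * indicator {b<..b+1} t)" if "1 \<le> b" for b
    using that by (auto simp: indicator_def)
  show "N (emb (\<lambda>t. r t * indicator {1<..real 0 + 2} t))
    \<le> N (emb (indicator {0<..1})) * (r 1 + (\<integral>\<^sup>+t. r t * indicator {1<..real 0 + 1} t \<partial>\<lambda>\<^sub>+))"
    using step[of 1] by simp
  fix n
  let ?c = "N (emb (indicator {0<..1}))" and ?I = "\<lambda>a b. \<integral>\<^sup>+t. r t * indicator {a<..b} t \<partial>\<lambda>\<^sub>+"
  let ?b = "real n + 2"
  assume IH: "N (emb (\<lambda>t. r t * indicator {1<..?b} t)) \<le> ?c * (r 1 + ?I 1 (real n + 1))"
  have cut: "(\<lambda>t. r t * indicator {a<..b} t) \<in> borel_measurable \<lambda>\<^sub>+" for a b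
    using cut_in_Mfun_plus[OF r, of "{a<..b}"] by (simp add: Mfun_plus_def)
  have I_split: "?I 1 (real n + 1 + 1) = ?I 1 (real n + 1) + ?I (real n + 1) (real n + 1 + 1)"
    by (subst split, simp) (rule nn_integral_add[OF cut cut])
  have "N (emb (\<lambda>t. r t * indicator {1<..?b+1} t))
      \<le> N (emb (\<lambda>t. r t * indicator {1<..?b} t)) + N (emb (\<lambda>t. r t * indicator {?b<..?b+1} t))"
    by (subst split, simp) (intro P1_triangle cut_in_Mfun_plus[OF r], auto)
  also have "\<dots> \<le> ?c * (r 1 + ?I 1 (real n + 1)) + ?c * r ?b"
    by (intro add_mono IH step) simp
  \<comment> \<open>The value at the left end of the new interval is paid for by the integral over
    the unit interval just before it.\<close>
  also have "r ?b \<le> ?I (real n + 1) (real n + 1 + 1)"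
    using antimono_le_nn_integral_Ioc[OF r, of "real n + 1"] by (simp add: add.assoc)
  also have "?c * (r 1 + ?I 1 (real n + 1)) + ?c * ?I (real n + 1) (real n + 1 + 1)
      = ?c * (r 1 + ?I 1 (real n + 1 + 1))"
    by (subst I_split) (simp only: distrib_left add.assoc)
  finally show "N (emb (\<lambda>t. r t * indicator {1<..real (Suc n) + 2} t))
      \<le> ?c * (r 1 + ?I 1 (real (Suc n) + 1))"
    by (simp add: add_ac mult_left_mono)
qed

text \<open>The bounds for the truncations at \<open>n + 2\<close> are uniform in \<open>n\<close>
  once the integral is extended to the whole tail, so \<open>P3\<close> passes to the limit.\<close>

lemma norm_tail_le:
  assumes r: "antimono r" and fin: "r 1 < \<infinity>"
  shows "N (emb (\<lambda>t. r t * indicator {1<..} t))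
    \<le> N (emb (indicator {0<..1})) * (r 1 + L1_norm (emb (\<lambda>t. r t * indicator {1<..} t)))"
proof -
  let ?F = "\<lambda>n t. r t * indicator {1<..real n + 2} t"
  have inc: "incseq (\<lambda>n. ?F n t)" for t
    by (auto simp: incseq_def indicator_def)
  have "(\<lambda>n. ?F n t) \<longlonglongrightarrow> r t * indicator {1<..} t" for t
  proof (rule tendsto_eventually)
    obtain m :: nat where "t \<le> real m" using real_arch_simple by blast
    \<comment> \<open>At each point the truncations are eventually constant, so convergence is clear
      even where \<open>r\<close> is infinite.\<close>
    then have "?F n t = r t * indicator {1<..} t" if "m \<le> n" for n
      using that by (auto simp: indicator_def)
    then show "\<forall>\<^sub>F n in sequentially. ?F n t = r t * indicator {1<..} t"
      unfolding eventually_sequentially by blast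
  qed
  then have "(\<lambda>n. N (emb (?F n))) \<longlonglongrightarrow> N (emb (\<lambda>t. r t * indicator {1<..} t))"
    by (intro P3[THEN conjunct2] cut_in_Mfun_plus[OF r] AE_I2 conjI inc) auto
  moreover have "N (emb (?F n))
      \<le> N (emb (indicator {0<..1})) * (r 1 + L1_norm (emb (\<lambda>t. r t * indicator {1<..} t)))" for n
    unfolding L1_norm_emb
    by (rule order_trans[OF norm_cut_Ioc_le[OF r fin]],
        intro mult_left_mono add_left_mono nn_integral_mono) (auto simp: indicator_def)
  ultimately show ?thesis
    by (intro LIMSEQ_le_const2) auto
qed

end

section \<open>The four embeddings and their constants\<close>

lemma embeddedI:
  assumes "K < \<infinity>" and "\<And>f. f \<in> space_of Y \<Longrightarrow> X f \<le> K * Y f"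
  shows "Y \<hookrightarrow> X"
proof -
  \<comment> \<open>The inclusion of the spaces follows from the norm inequality because
    \<open>K\<close> is finite.\<close>
  have "X f < \<infinity>" if "f \<in> space_of Y" for f
    using assms(2)[OF that] assms(1) that
    by (auto simp: space_of_def ennreal_mult_less_top intro: le_less_trans)
  with assms show ?thesis
    unfolding embedded_def by (auto simp: space_of_def)
qed

theorem theorem3p14:
  fixes A B :: fnorm
  assumes "ri_banach_function_norm A" and "ri_banach_function_norm B"
  shows "WL Linf_norm B \<hookrightarrow> WL A B \<and>
         WL A L1_norm \<hookrightarrow> WL A B \<and>
         WL A B \<hookrightarrow> WL L1_norm B \<and>
         WL A B \<hookrightarrow> WL A Linf_norm"
proof -
  interpret A: ri_banach_function_norm A by fact
  interpret B: ri_banach_function_norm B by fact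
  let ?lo = "\<lambda>f. emb (\<lambda>t. rearr f t * indicator {0..1} t)"
  let ?hi = "\<lambda>f. emb (\<lambda>t. rearr f t * indicator {1<..} t)"
  note r = antimono_rearr
  \<comment> \<open>This one constant enters the embeddings (2), (3) and (4).\<close>
  obtain C where C: "C < \<infinity>" and L1_lo: "\<And>f. L1_norm (?lo f) \<le> C * A (?lo f)"
    using A.L1_cut_le_norm r by blast
  have one_le: "rearr f 1 \<le> C * A (?lo f)" for f
    using antimono_one_le_L1_cut[OF r] L1_lo by (rule order_trans)

  have "WL Linf_norm B \<hookrightarrow> WL A B"
  proof (rule embeddedI)
    \<comment> \<open>The factor for the local half, finite by \<open>P4\<close>; the extra 1 covers
      the \<open>B\<close>-half, which both amalgam norms share.\<close>
    let ?K = "A (emb (indicator {0..1}))"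
    show "?K + 1 < \<infinity>"
      using A.P4[of "{0..1}"] by (simp add: borel_in_sets_halfline emeasure_restrict_space)
    fix f assume "f \<in> space_of (WL Linf_norm B)"
    then have "A (?lo f) \<le> ?K * Linf_norm (?lo f)"
      by (intro A.norm_cut_le_esssup r) (simp add: space_of_def WL_def)
    then have "WL A B f \<le> ?K * Linf_norm (?lo f) + B (?hi f)"
      unfolding WL_def by (rule add_right_mono)
    also have "\<dots> \<le> (?K + 1) * WL Linf_norm B f"
      unfolding WL_def distrib_left by (intro add_mono) (simp_all add: distrib_right)
    finally show "WL A B f \<le> (?K + 1) * WL Linf_norm B f" .
  qed

  moreover have "WL A L1_norm \<hookrightarrow> WL A B"
  proof (rule embeddedI)
    let ?c = "B (emb (indicator {0<..1}))"
    have c: "?c < \<infinity>"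
      using B.P4[OF borel_in_sets_halfline, of "{0<..1}"] by (force simp: emeasure_halfline_Ioc)
    then show "1 + ?c * C + ?c < \<infinity>"
      using C by (auto simp: ennreal_mult_less_top)
    fix f assume "f \<in> space_of (WL A L1_norm)"
    \<comment> \<open>The local norm is a summand of a finite amalgam norm, so \<open>one_le\<close>
      makes \<open>rearr f 1\<close> finite, as \<open>B.norm_tail_le\<close> requires.\<close>
    then have "rearr f 1 < \<infinity>"
      using one_le[of f] C
      by (auto simp: space_of_def WL_def ennreal_mult_less_top intro: le_less_trans)
    then have "B (?hi f) \<le> ?c * (rearr f 1 + L1_norm (?hi f))"
      by (rule B.norm_tail_le[OF r])
    also have "\<dots> \<le> ?c * (C * A (?lo f) + L1_norm (?hi f))"
      by (intro mult_left_mono add_right_mono one_le) simp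
    finally have "WL A B f \<le> A (?lo f) + ?c * (C * A (?lo f) + L1_norm (?hi f))"
      unfolding WL_def by (rule add_left_mono)
    also have "\<dots> = (1 + ?c * C) * A (?lo f) + ?c * L1_norm (?hi f)"
      by (simp add: distrib_left distrib_right ac_simps)
    \<comment> \<open>The sum of the coefficients of the two halves dominates each of them.\<close>
    also have "\<dots> \<le> (1 + ?c * C + ?c) * WL A L1_norm f"
      unfolding WL_def distrib_left by (rule add_mono[OF mult_right_mono mult_right_mono]) simp_all
    finally show "WL A B f \<le> (1 + ?c * C + ?c) * WL A L1_norm f" .
  qed

  moreover have "WL A B \<hookrightarrow> WL L1_norm B"
  proof (rule embeddedI)
    show "C + 1 < \<infinity>" using C by simp
    fix f
    have "WL L1_norm B f \<le> C * A (?lo f) + B (?hi f)"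
      unfolding WL_def using L1_lo by (rule add_right_mono)
    also have "\<dots> \<le> (C + 1) * WL A B f"
      unfolding WL_def distrib_left by (intro add_mono) (simp_all add: distrib_right)
    finally show "WL L1_norm B f \<le> (C + 1) * WL A B f" .
  qed

  moreover have "WL A B \<hookrightarrow> WL A Linf_norm"
  proof (rule embeddedI)
    show "1 + C < \<infinity>" using C by simp
    fix f
    \<comment> \<open>The essential supremum over the tail is at most \<open>rearr f 1\<close>,
      which the local \<open>A\<close>-norm controls with factor \<open>C\<close>.\<close>
    have "WL A Linf_norm f \<le> A (?lo f) + C * A (?lo f)"
      unfolding WL_def using order_trans[OF Linf_cut_le[OF r] one_le] by (rule add_left_mono)
    also have "\<dots> \<le> (1 + C) * WL A B f"
      unfolding WL_def by (simp add: distrib_left distrib_right)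
    finally show "WL A Linf_norm f \<le> (1 + C) * WL A B f" .
  qed

  ultimately show ?thesis by blast
qed

end
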